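(* Let $R$ be a commutative topological ring and consider the map $f:R^{\ast}\rightarrow R\times R$ given by $a\mapsto(a,a^{-1})$, where $R\times R$ has the product topology. Let $\mathscr{T}$ be the subspace topology on $R^{\ast}$ (induced from $R$) and let $\mathscr{T}_{f}$ be the topology on $R^{\ast}$ induced by $f$. Then $R^{\ast}$ with the subspace topology $\mathscr{T}$ is a topological group if and only if $\mathscr{T}=\mathscr{T}_{f}$.
   Context: Rings are commutative with identity. A topological ring is a ring with a topology for which the ring operations are continuous. $R^{\ast}$ is the group of units of $R$. The topology on $R^{\ast}$ induced by $f$ is $\mathscr{T}_{f}=\{f^{-1}(W): W\subseteq R\times R \text{ open}\}$. No separation axiom is assumed. *)

theory Defs
  imports "HOL-Analysis.Abstract_Topology" "HOL-Analysis.Product_Topology" "HOL-Algebra.Ring"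
begin

definition topological_ring :: "('a, 'm) ring_scheme \<Rightarrow> 'a topology \<Rightarrow> bool" where
  "topological_ring R T \<longleftrightarrow>
     ring R \<and> topspace T = carrier R \<and>
     continuous_map (prod_topology T T) T (\<lambda>(x, y). x \<oplus>\<^bsub>R\<^esub> y) \<and>
     continuous_map T T (\<lambda>x. \<ominus>\<^bsub>R\<^esub> x) \<and>
     continuous_map (prod_topology T T) T (\<lambda>(x, y). x \<otimes>\<^bsub>R\<^esub> y)"

definition topological_group :: "('a, 'm) monoid_scheme \<Rightarrow> 'a topology \<Rightarrow> bool" where
  "topological_group G T \<longleftrightarrow>
     group G \<and> topspace T = carrier G \<and>
     continuous_map (prod_topology T T) T (\<lambda>(x, y). x \<otimes>\<^bsub>G\<^esub> y) \<and>
     continuous_map T T (\<lambda>x. inv\<^bsub>G\<^esub> x)"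

end

theory Submission
  imports Defs
begin

text \<open>
  Multiplication on the units is a restriction of the multiplication of \<open>R\<close>, so it is always
  continuous for the subspace topology; hence the subspace topology makes the units a topological
  group exactly when inversion is continuous (\<open>topological_group_units_iff\<close>).

  On the other side, \<open>a \<mapsto> (a, a\<^sup>-\<^sup>1)\<close> is the graph map of inversion. A map into a product is
  continuous iff its components are, and the first component of a graph map is the inclusion.
  The topology pulled back along it is therefore the coarsest one for which both the inclusion and
  inversion are continuous: it is the subspace topology exactly when inversion is already
  continuous for that one (\<open>subtopology_eq_pullback_graph_iff\<close>).
\<close>

text \<open>
  Every relatively open \<open>V \<inter> A\<close> is the preimage of the open set \<open>V \<times> topspace Y\<close> under the graph
  map, so the subspace topology is always the coarser one. Equality thus only asks that the graph
  map be continuous for it, and this rests on its second component.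
\<close>

lemma subtopology_eq_pullback_graph_iff:
  assumes "A \<subseteq> topspace X" and "g ` A \<subseteq> topspace Y"
  shows "subtopology X A = pullback_topology A (\<lambda>a. (a, g a)) (prod_topology X Y)
         \<longleftrightarrow> continuous_map (subtopology X A) Y g"
    (is "?S = ?P \<longleftrightarrow> _")
proof
  assume eq: "?S = ?P"
  have "continuous_map ?P Y (snd \<circ> (\<lambda>a. (a, g a)))"
    by (rule continuous_map_pullback) (rule continuous_map_snd)
  then show "continuous_map ?S Y g"
    by (simp add: eq o_def)
next
  assume "continuous_map ?S Y g"
  then have graph: "continuous_map ?S (prod_topology X Y) (\<lambda>a. (a, g a))"
    by (simp add: continuous_map_pairedI continuous_map_from_subtopology)
  show "?S = ?P"
    unfolding topology_eq
  proof (intro allI iffI)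
    fix U
    assume "openin ?S U"
    then obtain V where V: "openin X V" "U = V \<inter> A"
      by (auto simp: openin_subtopology)
    then have "openin (prod_topology X Y) (V \<times> topspace Y)"
      by (simp add: openin_prod_Times_iff)
    moreover have "U = (\<lambda>a. (a, g a)) -` (V \<times> topspace Y) \<inter> A"
      using V assms(2) by auto
    ultimately show "openin ?P U"
      unfolding openin_pullback_topology by blast
  next
    fix U
    assume "openin ?P U"
    then obtain W where W: "openin (prod_topology X Y) W" "U = (\<lambda>a. (a, g a)) -` W \<inter> A"
      unfolding openin_pullback_topology by blast
    have "U = {a \<in> topspace ?S. (a, g a) \<in> W}"
      using W(2) assms(1) by auto
    then show "openin ?S U"
      using openin_continuous_map_preimage[OF graph W(1)] by simp
  qed
qed

text \<open>
  Units form an algebraic group in any monoid, and products and inverses of units are again units.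
  Continuity into the subspace of units is thus the same as continuity into the whole space, where
  multiplication is continuous by assumption and only inversion remains in question.
\<close>

lemma (in monoid) topological_group_units_iff:
  assumes top: "topspace T = carrier G"
    and mult: "continuous_map (prod_topology T T) T (\<lambda>(x, y). x \<otimes> y)"
  shows "topological_group (units_of G) (subtopology T (Units G))
         \<longleftrightarrow> continuous_map (subtopology T (Units G)) T (\<lambda>a. inv a)"
    (is "_ \<longleftrightarrow> continuous_map ?S T _")
proof -
  have space: "topspace ?S = Units G"
    using top Units_closed by auto
  have "continuous_map (prod_topology ?S ?S) T (\<lambda>(x, y). x \<otimes> y)"
    using mult by (simp add: subtopology_Times[symmetric] continuous_map_from_subtopology)
  then have "continuous_map (prod_topology ?S ?S) ?S (\<lambda>(x, y). x \<otimes> y)"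
    by (auto simp: continuous_map_in_subtopology space)
  moreover have "continuous_map ?S ?S (\<lambda>a. inv\<^bsub>units_of G\<^esub> a)
                 \<longleftrightarrow> continuous_map ?S ?S (\<lambda>a. inv a)"
    using space units_of_inv by (metis (no_types, lifting) continuous_map_eq)
  moreover have "continuous_map ?S ?S (\<lambda>a. inv a) \<longleftrightarrow> continuous_map ?S T (\<lambda>a. inv a)"
    by (auto simp: continuous_map_in_subtopology space)
  ultimately show ?thesis
    using space by (simp add: topological_group_def units_group units_of_carrier units_of_mult)
qed

theorem corollary2p7:
  fixes R :: "('a, 'm) ring_scheme" and T :: "'a topology"
  assumes "cring R" and "topological_ring R T"
  shows "topological_group (units_of R) (subtopology T (Units R)) \<longleftrightarrow>
         subtopology T (Units R) =
           pullback_topology (Units R) (\<lambda>a. (a, inv\<^bsub>R\<^esub> a)) (prod_topology T T)"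
proof -
  interpret cring R by fact
  have top: "topspace T = carrier R"
    and mult: "continuous_map (prod_topology T T) T (\<lambda>(x, y). x \<otimes>\<^bsub>R\<^esub> y)"
    using assms(2) by (simp_all add: topological_ring_def)
  have "Units R \<subseteq> topspace T" "(\<lambda>a. inv\<^bsub>R\<^esub> a) ` Units R \<subseteq> topspace T"
    using top by auto
  then show ?thesis
    using topological_group_units_iff[OF top mult] subtopology_eq_pullback_graph_iff by metis
qed

end
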